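(* Let $F:\mathbb{R}^d\to\mathbb{R}$ be a differentiable function satisfying the smoothness assumption (S) with constant $L$ and the coercivity assumption (C), and let $(X_n,Y_n)_{n\ge 0}$ be the iterates of either GDxLD or nGDxLD with deterministic initial points $X_0,Y_0\in\mathbb{R}^d$, temperature $\gamma>0$, step size $h$ and threshold $t_0$, where $\gamma,h,t_0$ are fixed constants not depending on $\epsilon,\delta$. (1) Suppose in addition that the local strong convexity assumption (SC) holds, $0<h\le \frac{1}{2L}$ and $0\le t_0\le r_0/8$. Then for every $\epsilon>0$ and $\delta>0$ there exists $N(\epsilon,\delta)$, with $N(\epsilon,\delta)=O(\log(1/\epsilon))+O(\log(1/\delta))$, such that for every $n\ge N(\epsilon,\delta)$, $$\mathbb{P}\big(F(X_n)-F(x^* )\le\epsilon\big)\ge 1-\delta .$$ (2) Alternatively, suppose in addition that the local convexity assumption (LC) holds, $0<h\le\min\{\frac{1}{2L},\frac{r_u^2}{r_0}\}$ and $0\le t_0\le r_0/8$. Then for every $\epsilon>0$ and $\delta>0$ the same conclusion holds with $N(\epsilon,\delta)=O(\epsilon^{-1})+O(\log(1/\delta))$. Here the $O(\cdot)$ bounds are for small $\epsilon,\delta$ (say $\epsilon,\delta\in(0,1/2)$), with implicit constants that do not depend on $\epsilon,\delta$ (they may depend on $F,d,\gamma,h,t_0,X_0,Y_0$).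
   Context: Algorithms GDxLD and nGDxLD. Given $X_0,Y_0$, temperature $\gamma>0$, step size $h>0$, threshold $t_0\ge0$, and i.i.d. $Z_0,Z_1,\dots\sim\mathcal N(0,I_d)$, for $n\ge0$ set $$X'_{n+1}=X_n-h\nabla F(X_n),\qquad Y'_{n+1}=Y_n-h\nabla F(Y_n)+\sqrt{2\gamma h}\,Z_n .$$ If $F(Y'_{n+1})<F(X'_{n+1})-t_0$, then set $(X_{n+1},Y_{n+1})=(Y'_{n+1},X'_{n+1})$ for GDxLD, and $(X_{n+1},Y_{n+1})=(Y'_{n+1},Y'_{n+1})$ for nGDxLD. Otherwise set $(X_{n+1},Y_{n+1})=(X'_{n+1},Y'_{n+1})$. Assumptions. (S) There is $L\in(0,\infty)$ with $\|\nabla F(x)-\nabla F(y)\|\le L\|x-y\|$ for all $x,y\in\mathbb{R}^d$. (C) There are $\lambda_c,M_c\in(0,\infty)$ with $\|\nabla F(x)\|^2\ge\lambda_cF(x)-M_c$ for all $x$, and $F(x)\to\infty$ as $\|x\|\to\infty$. (SC) $x^*$ is the unique global minimum of $F$. There is $r_0>0$ such that the sub-level set $B_0=\{x:F(x)\le F(x^* )+r_0\}$ is star-convex with center $x^*$ (for each $x\in B_0$ the segment from $x^*$ to $x$ lies in $B_0$). There are $m,M,r>0$ such that $B_0\subset\{x:\|x-x^*\|<r\}$, the Hessian $\nabla^2F(x)$ exists for all $\|x-x^*\|<r$, and $m\|v\|^2\le v^T\nabla^2F(x)v\le M\|v\|^2$ for all vectors $v$ and all $x$ with $\|x-x^*\|<r$.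 (LC) $x^*$ is the unique global minimum of $F$. There is $r_0>0$ such that $B_0=\{x:F(x)\le F(x^* )+r_0\}$ is star-convex with center $x^*$, $F$ is convex in $B_0$, and there are $0<r_l<r_u<\infty$ with $\{x:\|x-x^*\|\le r_l\}\subset B_0\subset\{x:\|x-x^*\|\le r_u\}$. *)

theory Defs
  imports "HOL-Probability.Probability"
begin

(* Only meaningful where F is differentiable; there the gradient is unique. *)
definition grad :: "(real ^ 'd \<Rightarrow> real) \<Rightarrow> real ^ 'd \<Rightarrow> real ^ 'd" where
  "grad F x = (THE D. GDERIV F x :> D)"

(* The Hessian is the Jacobian matrix of the gradient map. *)
definition has_hessian :: "(real ^ 'd \<Rightarrow> real) \<Rightarrow> real ^ 'd ^ 'd \<Rightarrow> real ^ 'd \<Rightarrow> bool" where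
  "has_hessian F H x \<longleftrightarrow> (grad F has_derivative (\<lambda>v. H *v v)) (at x)"

(* Density of N(0, I_d) with respect to Lebesgue measure: product of the d standard
   one-dimensional densities. *)
definition std_gaussian_density :: "real ^ 'd \<Rightarrow> real" where
  "std_gaussian_density x = (\<Prod>i\<in>UNIV. std_normal_density (x $ i))"

definition iid_std_gaussian :: "'w measure \<Rightarrow> (nat \<Rightarrow> 'w \<Rightarrow> real ^ 'd) \<Rightarrow> bool" where
  "iid_std_gaussian P Z \<longleftrightarrow>
     prob_space.indep_vars P (\<lambda>_. borel) Z UNIV \<and>
     (\<forall>n. distributed P lborel (Z n) (\<lambda>x. ennreal (std_gaussian_density x)))"

datatype algorithm = GDxLD | nGDxLD

(* The pair (X_n, Y_n) as a function of the realised noise sequence z. *)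
primrec iterates ::
  "algorithm \<Rightarrow> (real ^ 'd \<Rightarrow> real) \<Rightarrow> real \<Rightarrow> real \<Rightarrow> real \<Rightarrow> real ^ 'd \<Rightarrow> real ^ 'd
    \<Rightarrow> (nat \<Rightarrow> real ^ 'd) \<Rightarrow> nat \<Rightarrow> (real ^ 'd) \<times> (real ^ 'd)" where
  "iterates alg F \<gamma> h t0 x0 y0 z 0 = (x0, y0)"
| "iterates alg F \<gamma> h t0 x0 y0 z (Suc n) =
    (let (x, y) = iterates alg F \<gamma> h t0 x0 y0 z n;
         x' = x - h *\<^sub>R grad F x;
         y' = y - h *\<^sub>R grad F y + sqrt (2 * \<gamma> * h) *\<^sub>R z n
     in if F y' < F x' - t0
        then (case alg of GDxLD \<Rightarrow> (y', x') | nGDxLD \<Rightarrow> (y', y'))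
        else (x', y'))"

definition smooth_assm :: "(real ^ 'd \<Rightarrow> real) \<Rightarrow> real \<Rightarrow> bool" where
  "smooth_assm F L \<longleftrightarrow> 0 < L \<and> L-lipschitz_on UNIV (grad F)"

definition coercive_assm :: "(real ^ 'd \<Rightarrow> real) \<Rightarrow> bool" where
  "coercive_assm F \<longleftrightarrow>
     (\<exists>lc>0. \<exists>Mc>0. \<forall>x. (norm (grad F x))\<^sup>2 \<ge> lc * F x - Mc) \<and>
     filterlim F at_top at_infinity"

definition unique_global_min :: "(real ^ 'd \<Rightarrow> real) \<Rightarrow> real ^ 'd \<Rightarrow> bool" where
  "unique_global_min F xs \<longleftrightarrow> (\<forall>x. x \<noteq> xs \<longrightarrow> F xs < F x)"

definition sublevel :: "(real ^ 'd \<Rightarrow> real) \<Rightarrow> real ^ 'd \<Rightarrow> real \<Rightarrow> (real ^ 'd) set" where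
  "sublevel F xs r0 = {x. F x \<le> F xs + r0}"

definition star_convex_at :: "(real ^ 'd) set \<Rightarrow> real ^ 'd \<Rightarrow> bool" where
  "star_convex_at S c \<longleftrightarrow> (\<forall>x\<in>S. closed_segment c x \<subseteq> S)"

(* The constant convex_on already demands that the set be convex, whereas the sub-level set is
   only assumed star-convex.  For convex S this is equivalent to convex_on S F. *)
definition convex_in :: "(real ^ 'd) set \<Rightarrow> (real ^ 'd \<Rightarrow> real) \<Rightarrow> bool" where
  "convex_in S F \<longleftrightarrow> (\<forall>C. convex C \<and> C \<subseteq> S \<longrightarrow> convex_on C F)"

definition local_strong_convex_assm ::
  "(real ^ 'd \<Rightarrow> real) \<Rightarrow> real ^ 'd \<Rightarrow> real \<Rightarrow> bool" where
  "local_strong_convex_assm F xs r0 \<longleftrightarrow>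
     unique_global_min F xs \<and> 0 < r0 \<and> star_convex_at (sublevel F xs r0) xs \<and>
     (\<exists>m>0. \<exists>M>0. \<exists>r>0. sublevel F xs r0 \<subseteq> {x. norm (x - xs) < r} \<and>
        (\<forall>x. norm (x - xs) < r \<longrightarrow>
           (\<exists>H. has_hessian F H x \<and>
              (\<forall>v. m * (norm v)\<^sup>2 \<le> v \<bullet> (H *v v) \<and> v \<bullet> (H *v v) \<le> M * (norm v)\<^sup>2))))"

definition local_convex_assm ::
  "(real ^ 'd \<Rightarrow> real) \<Rightarrow> real ^ 'd \<Rightarrow> real \<Rightarrow> real \<Rightarrow> bool" where
  "local_convex_assm F xs r0 ru \<longleftrightarrow>
     unique_global_min F xs \<and> 0 < r0 \<and> star_convex_at (sublevel F xs r0) xs \<and>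
     convex_in (sublevel F xs r0) F \<and>
     (\<exists>rl>0. rl < ru \<and> {x. norm (x - xs) \<le> rl} \<subseteq> sublevel F xs r0 \<and>
        sublevel F xs r0 \<subseteq> {x. norm (x - xs) \<le> ru})"

end

theory Submission
  imports Defs
begin

text \<open>
  Write \<open>B\<close> for the sub-level set \<open>sublevel F xs r0\<close>. The argument separates a random phase, in which \<open>X\<close>
  gets into \<open>B\<close>, from a deterministic phase inside \<open>B\<close>; the first contributes the \<open>ln (1 / \<delta>)\<close> and the
  second the dependence on \<open>\<epsilon>\<close>.

  A swap only replaces the gradient step of \<open>X\<close> by a point with a smaller value of \<open>F\<close>. So along
  every realisation \<open>F X\<^sub>n\<close> decreases at least as much as in a gradient step, by \<open>h / 2\<close> times the
  squared gradient norm (\<open>gradient_step\<close>), and \<open>X\<close> never leaves \<open>B\<close> once it is there.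

  Random phase. Outside compact sets \<open>F Y\<^sub>n\<close> decreases on average, by coercivity
  (\<open>langevin_drift\<close>). A swap either leaves \<open>Y\<close> where it is, for nGDxLD, or moves it to a point where
  \<open>F\<close> is at most \<open>F X\<^sub>0\<close>, for GDxLD; this only enlarges the additive constant. From a compact set,
  the Gaussian noise throws \<open>Y\<close> close to the minimiser with probability bounded below
  (\<open>langevin_minorisation\<close>), and then, the threshold being small compared with \<open>r0\<close>, \<open>X\<close> ends up in
  \<open>B\<close> with or without a swap. Both facts together say that the expectation of the excess of \<open>Y\<close>
  plus a large constant, restricted to the event that \<open>X\<close> is not yet in \<open>B\<close>, shrinks by a fixed
  factor in every step (\<open>lyapunov_contraction\<close>). Hence the probability of this event decays
  geometrically (\<open>captured_with_high_probability\<close>).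

  Deterministic phase. In \<open>B\<close>, let \<open>a\<close> be the excess of \<open>F X\<close> over the minimum. Strong convexity
  bounds the squared gradient norm below by a multiple of \<open>a\<close>, so \<open>a\<close> decays geometrically.
  Convexity bounds it below by \<open>(a / ru)\<^sup>2\<close>, so \<open>a\<close> decays like \<open>1 / n\<close> (\<open>quadratic_decay\<close>).
\<close>

section \<open>Gradients, descent and noisy descent\<close>

text \<open>
  Riesz representation, by hand: the coordinates of the gradient are the values of the derivative on
  the basis.
\<close>

lemma grad_has_derivative:
  fixes F :: "real ^ 'd \<Rightarrow> real"
  assumes "F differentiable (at x)"
  shows "(F has_derivative (\<lambda>v. v \<bullet> grad F x)) (at x)"
proof -
  obtain F' where F': "(F has_derivative F') (at x)"
    using assms by (auto simp: differentiable_def)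
  then interpret linear F' by (rule has_derivative_linear)
  define D where "D = (\<Sum>b\<in>Basis. F' b *\<^sub>R b)"
  have "F' v = v \<bullet> D" for v
  proof -
    have "F' v = F' (\<Sum>b\<in>Basis. (v \<bullet> b) *\<^sub>R b)" by (simp add: euclidean_representation)
    also have "\<dots> = (\<Sum>b\<in>Basis. (v \<bullet> b) * F' b)" by (simp add: sum scale)
    finally show ?thesis by (simp add: D_def inner_sum_right mult.commute)
  qed
  then have D: "GDERIV F x :> D"
    using F' unfolding gderiv_def by (metis ext)
  have "grad F x = D"
    unfolding grad_def
  proof (rule the_equality)
    show "GDERIV F x :> D" by (fact D)
  next
    fix E assume "GDERIV F x :> E"
    then have "(\<lambda>v. v \<bullet> E) = (\<lambda>v. v \<bullet> D)"
      using D unfolding gderiv_def by (rule has_derivative_unique)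
    then show "E = D"
      by (metis inner_commute vector_eq_rdot)
  qed
  with D show ?thesis by (simp add: gderiv_def)
qed

locale smooth_minimisation =
  fixes F :: "real ^ 'd \<Rightarrow> real" and L h :: real and xs :: "real ^ 'd"
  assumes differentiable: "F differentiable_on UNIV"
    and smooth: "smooth_assm F L"
    and step_pos: "0 < h" and step_le: "h \<le> 1 / (2 * L)"
    and minimum: "unique_global_min F xs"
begin

lemma min_le: "F xs \<le> F x"
  using minimum unfolding unique_global_min_def by (cases "x = xs") (auto intro: less_imp_le)

lemma L_pos: "0 < L"
  using smooth by (simp add: smooth_assm_def)

lemma Lh_le: "L * h \<le> 1 / 2"
  using step_le L_pos by (simp add: field_simps)

lemma grad_lipschitz: "norm (grad F x - grad F y) \<le> L * norm (x - y)"
  using smooth unfolding smooth_assm_def lipschitz_on_def by (auto simp: dist_norm)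

lemma has_derivative_grad: "(F has_derivative (\<lambda>v. v \<bullet> grad F x)) (at x)"
  using differentiable
  by (intro grad_has_derivative) (auto simp: differentiable_on_def)

lemma continuous_F: "continuous_on A F"
  using differentiable differentiable_imp_continuous_on continuous_on_subset by blast

lemma continuous_grad: "continuous_on A (grad F)"
  using smooth unfolding smooth_assm_def
  by (meson continuous_on_subset lipschitz_on_continuous_on top_greatest)

lemma measurable_F [measurable]: "F \<in> borel_measurable borel"
  using continuous_F by (rule borel_measurable_continuous_onI)

lemma measurable_grad [measurable]: "grad F \<in> borel_measurable borel"
  using continuous_grad by (rule borel_measurable_continuous_onI)

lemma mean_value:
  obtains t where "t \<in> {0..1}" "F (x + v) - F x = v \<bullet> grad F (x + t *\<^sub>R v)"
proof -
  have "((\<lambda>t. F (x + t *\<^sub>R v)) has_derivative (\<lambda>s. (s *\<^sub>R v) \<bullet> grad F (x + t *\<^sub>R v)))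
      (at t within {0..1})" for t :: real
    by (rule has_derivative_compose[OF _ has_derivative_grad]) (auto intro!: derivative_eq_intros)
  from mvt_very_simple[of 0 1, OF _ this] obtain t :: real where
    "t \<in> {0..1}" "F (x + 1 *\<^sub>R v) - F (x + 0 *\<^sub>R v) = ((1 - 0) *\<^sub>R v) \<bullet> grad F (x + t *\<^sub>R v)"
    by auto
  then show ?thesis by (intro that[of t]) auto
qed

text \<open>
  The mean value theorem along the segment gives the constant \<open>L\<close>, where integration would give
  \<open>L / 2\<close>. The cruder constant suffices, since step sizes with \<open>L h \<le> 1 / 2\<close> still leave half of the
  first-order decrease in the gradient step.
\<close>

lemma quadratic_bound: "\<bar>F (x + v) - F x - v \<bullet> grad F x\<bar> \<le> L * (norm v)\<^sup>2"
proof -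
  obtain t where t: "t \<in> {0..1}" "F (x + v) - F x = v \<bullet> grad F (x + t *\<^sub>R v)"
    by (rule mean_value)
  have "\<bar>F (x + v) - F x - v \<bullet> grad F x\<bar> = \<bar>v \<bullet> (grad F (x + t *\<^sub>R v) - grad F x)\<bar>"
    by (simp add: t inner_diff_right)
  also have "\<dots> \<le> norm v * norm (grad F (x + t *\<^sub>R v) - grad F x)"
    by (rule Cauchy_Schwarz_ineq2)
  also have "\<dots> \<le> norm v * (L * norm (t *\<^sub>R v))"
    using grad_lipschitz[of "x + t *\<^sub>R v" x] by (intro mult_left_mono) auto
  also have "\<dots> \<le> norm v * (L * norm v)"
    using t L_pos by (intro mult_left_mono) (auto simp: mult_left_le_one_le)
  finally show ?thesis by (simp add: power2_eq_square mult_ac)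
qed

lemma gradient_step: "F (x - h *\<^sub>R grad F x) \<le> F x - h / 2 * (norm (grad F x))\<^sup>2"
proof -
  let ?g = "grad F x"
  have "F (x - h *\<^sub>R ?g) \<le> F x - h * (norm ?g)\<^sup>2 + L * h * (h * (norm ?g)\<^sup>2)"
    using quadratic_bound[of x "- h *\<^sub>R ?g"]
    by (simp add: abs_le_iff power_mult_distrib dot_square_norm power2_eq_square algebra_simps step_pos less_imp_le)
  also have "L * h * (h * (norm ?g)\<^sup>2) \<le> 1 / 2 * (h * (norm ?g)\<^sup>2)"
    using Lh_le step_pos by (intro mult_right_mono) auto
  finally show ?thesis by simp
qed

lemma gradient_step_le: "F (x - h *\<^sub>R grad F x) \<le> F x"
  using gradient_step[of x] step_pos by (smt (verit) divide_pos_pos mult_nonneg_nonneg zero_le_power2)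

text \<open>
  A gradient step from the minimiser cannot decrease \<open>F\<close>.
\<close>

lemma grad_minimum: "grad F xs = 0"
proof -
  have "h / 2 * (norm (grad F xs))\<^sup>2 \<le> 0"
    using gradient_step[of xs] min_le[of "xs - h *\<^sub>R grad F xs"] by simp
  then show ?thesis using step_pos by (simp add: mult_le_0_iff)
qed

text \<open>
  The first-order effect of the perturbation \<open>u\<close> is split by Young's inequality: one part is
  paid for by half of the decrease of the gradient step, the other is quadratic in \<open>u\<close>. In this form
  the expected increase caused by a random \<open>u\<close> is controlled by its second moment alone.
\<close>

lemma noisy_gradient_step:
  "F (x - h *\<^sub>R grad F x + u)
     \<le> F x - h / 4 * (norm (grad F x))\<^sup>2 + (L + 9 / (4 * h)) * (norm u)\<^sup>2"
proof -
  let ?g = "grad F x" and ?w = "x - h *\<^sub>R grad F x"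
  have "norm (grad F ?w) \<le> norm ?g + norm (grad F ?w - ?g)"
    by (metis add.commute diff_add_cancel norm_triangle_ineq)
  also have "norm (grad F ?w - ?g) \<le> L * h * norm ?g"
    using grad_lipschitz[of ?w x] step_pos by simp
  also have "L * h * norm ?g \<le> 1 / 2 * norm ?g"
    using Lh_le by (intro mult_right_mono) auto
  finally have g: "norm (grad F ?w) \<le> 3 / 2 * norm ?g" by simp
  have "u \<bullet> grad F ?w \<le> norm u * norm (grad F ?w)" by (rule norm_cauchy_schwarz)
  also have "\<dots> \<le> norm u * (3 / 2 * norm ?g)" by (intro mult_left_mono g) auto
  also have "\<dots> \<le> h / 4 * (norm ?g)\<^sup>2 + 9 / (4 * h) * (norm u)\<^sup>2"
  proof -
    \<comment> \<open>Young's inequality with the weights that leave exactly \<open>h / 4\<close> of the decrease \<open>h / 2\<close>.\<close>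
    have "0 \<le> (h * norm ?g - 3 * norm u)\<^sup>2 / (4 * h)" using step_pos by simp
    also have "\<dots> = h / 4 * (norm ?g)\<^sup>2 + 9 / (4 * h) * (norm u)\<^sup>2 - norm u * (3 / 2 * norm ?g)"
      using step_pos by (simp add: field_simps power2_eq_square)
    finally show ?thesis by simp
  qed
  finally have "u \<bullet> grad F ?w \<le> h / 4 * (norm ?g)\<^sup>2 + 9 / (4 * h) * (norm u)\<^sup>2" .
  then show ?thesis
    using quadratic_bound[of ?w u] gradient_step[of x] by (simp add: abs_le_iff algebra_simps)
qed

section \<open>Growth of the gradient near the minimiser\<close>

text \<open>
  The Polyak-Lojasiewicz inequality. On the segment from \<open>xs\<close> to \<open>x\<close>, which stays in the ball where the
  Hessian is at least \<open>m\<close>, the directional derivative \<open>g\<close> of \<open>F\<close> along \<open>v = x - xs\<close> grows with slope at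
  least \<open>m |v|\<^sup>2\<close> and vanishes at \<open>xs\<close>. So \<open>g 1\<close> is at least \<open>m |v|\<^sup>2\<close>, and, being the largest slope,
  at least \<open>F x - F xs\<close>; and \<open>g 1\<close> is at most \<open>|v| |grad F x|\<close>.
\<close>

lemma strong_convexity_imp_gradient_growth:
  assumes "local_strong_convex_assm F xs r0"
  obtains m where "m > 0"
    "\<And>x. x \<in> sublevel F xs r0 \<Longrightarrow> m * (F x - F xs) \<le> (norm (grad F x))\<^sup>2"
proof -
  obtain m M r where m: "0 < m" and sub: "sublevel F xs r0 \<subseteq> {x. norm (x - xs) < r}"
    and hess: "\<And>x. norm (x - xs) < r \<Longrightarrow> (\<exists>H. has_hessian F H x \<and>
              (\<forall>v. m * (norm v)\<^sup>2 \<le> v \<bullet> (H *v v) \<and> v \<bullet> (H *v v) \<le> M * (norm v)\<^sup>2))"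
    using assms unfolding local_strong_convex_assm_def by blast
  show thesis
  proof (rule that[OF m])
    fix x assume x: "x \<in> sublevel F xs r0"
    define v where "v = x - xs"
    define g where "g t = v \<bullet> grad F (xs + t *\<^sub>R v)" for t
    have in_ball: "norm (xs + t *\<^sub>R v - xs) < r" if "t \<in> {0..1}" for t :: real
      using that x sub mult_left_le_one_le[of "norm v" t] by (auto simp: v_def)
    have "\<exists>d. (g has_derivative (\<lambda>s. s * d)) (at t) \<and> m * (norm v)\<^sup>2 \<le> d"
      if t: "t \<in> {0..1}" for t
    proof -
      obtain H where H: "has_hessian F H (xs + t *\<^sub>R v)" "m * (norm v)\<^sup>2 \<le> v \<bullet> (H *v v)"
        using hess[OF in_ball[OF t]] by blast
      have "((\<lambda>t. grad F (xs + t *\<^sub>R v)) has_derivative (\<lambda>s. H *v (s *\<^sub>R v))) (at t)"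
        by (rule has_derivative_compose[where f = "\<lambda>t. xs + t *\<^sub>R v" and g = "grad F"])
           (use H(1) in \<open>auto simp: has_hessian_def intro!: derivative_eq_intros\<close>)
      then have "(g has_derivative (\<lambda>s. v \<bullet> (H *v (s *\<^sub>R v)))) (at t)"
        unfolding g_def by (rule has_derivative_inner_right)
      then show ?thesis
        using H(2) by (auto simp: matrix_vector_mult_scaleR mult.commute)
    qed
    then obtain d where d: "\<And>t. t \<in> {0..1} \<Longrightarrow> (g has_derivative (\<lambda>s. s * d t)) (at t)"
      "\<And>t. t \<in> {0..1} \<Longrightarrow> m * (norm v)\<^sup>2 \<le> d t"
      by metis
    have g_mono: "g 1 - g t \<ge> (1 - t) * (m * (norm v)\<^sup>2)" if t: "t \<in> {0..1}" for t
    proof -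
      have "(g has_derivative (\<lambda>u. u * d s)) (at s within {t..1})" if "t \<le> s" "s \<le> 1" for s
        using d(1)[of s] that t by (auto intro: has_derivative_at_withinI)
      from mvt_very_simple[of t 1 g, OF _ this] obtain s
        where "s \<in> {t..1}" "g 1 - g t = (1 - t) * d s"
        using t by auto
      then show ?thesis using d(2)[of s] t by (auto intro!: mult_left_mono)
    qed
    have "m * (norm v)\<^sup>2 \<le> g 1"
      using g_mono[of 0] by (simp add: g_def grad_minimum)
    also have "g 1 \<le> norm v * norm (grad F x)"
      using norm_cauchy_schwarz[of v "grad F x"] by (simp add: g_def v_def)
    finally have *: "m * norm v \<le> norm (grad F x)"
      by (cases "v = 0") (auto simp: power2_eq_square)
    obtain t where t: "t \<in> {0..1}" "F (xs + v) - F xs = g t"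
      unfolding g_def by (rule mean_value)
    have "F x - F xs \<le> g 1"
      using t g_mono[of t] m
      by (smt (verit, best) add_diff_cancel_left' atLeastAtMost_iff diff_add_cancel 
          mult_nonneg_nonneg v_def zero_le_power2 add.commute)
    also note \<open>g 1 \<le> norm v * norm (grad F x)\<close>
    finally have "m * (F x - F xs) \<le> m * norm v * norm (grad F x)"
      using m by simp
    also have "\<dots> \<le> norm (grad F x) * norm (grad F x)"
      by (intro mult_right_mono *) auto
    finally show "m * (F x - F xs) \<le> (norm (grad F x))\<^sup>2"
      by (simp add: power2_eq_square)
  qed
qed

text \<open>
  A convex function lies above its tangent at \<open>x\<close>, here evaluated at \<open>xs\<close>. Star-convexity
  makes the segment from \<open>xs\<close> to \<open>x\<close> a convex subset of the sub-level set, so that \<open>F\<close> is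
  convex on it. The tangent inequality is the limit \<open>t \<rightarrow> 0\<close> of the chord inequality at
  \<open>x + t (xs - x)\<close>, the quadratic bound controlling the error.
\<close>

lemma convexity_imp_gradient_growth:
  assumes "local_convex_assm F xs r0 ru" and x: "x \<in> sublevel F xs r0"
  shows "F x - F xs \<le> ru * norm (grad F x)"
proof -
  from assms have star: "closed_segment xs x \<subseteq> sublevel F xs r0"
    and cvx: "convex_in (sublevel F xs r0) F" and ru: "norm (x - xs) \<le> ru"
    unfolding local_convex_assm_def star_convex_at_def by auto
  have conv: "convex_on (closed_segment xs x) F"
    using star cvx unfolding convex_in_def by (auto simp: convex_closed_segment)
  define v where "v = xs - x"
  have *: "F x - F xs + v \<bullet> grad F x \<le> t * (L * (norm v)\<^sup>2)" if t: "0 < t" "t < 1" for t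
  proof -
    have "F (x + t *\<^sub>R v) \<le> (1 - t) * F x + t * F xs"
      using convex_onD[OF conv, of t x xs] t by (simp add: v_def algebra_simps)
    moreover have "F (x + t *\<^sub>R v) \<ge> F x + t * (v \<bullet> grad F x) - t * (t * (L * (norm v)\<^sup>2))"
      using quadratic_bound[of x "t *\<^sub>R v"]
      using t by (simp add: abs_le_iff power_mult_distrib power2_eq_square mult_ac)
    ultimately have "t * (F x - F xs + v \<bullet> grad F x) \<le> t * (t * (L * (norm v)\<^sup>2))"
      by (simp add: algebra_simps)
    then show ?thesis using t by simp
  qed
  have "((\<lambda>t. t * (L * (norm v)\<^sup>2)) \<longlongrightarrow> 0 * (L * (norm v)\<^sup>2)) (at_right 0)"
    by (intro tendsto_intros)
  moreover have "\<forall>\<^sub>F t in at_right 0. F x - F xs + v \<bullet> grad F x \<le> t * (L * (norm v)\<^sup>2)"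
    using * by (auto simp: eventually_at_right_field intro!: exI[of _ 1])
  ultimately have "F x - F xs + v \<bullet> grad F x \<le> 0 * (L * (norm v)\<^sup>2)"
    by (rule tendsto_lowerbound) simp
  then have "F x - F xs \<le> (- v) \<bullet> grad F x" by simp
  also have "\<dots> \<le> norm (x - xs) * norm (grad F x)"
    using norm_cauchy_schwarz[of "- v" "grad F x"] by (simp add: v_def)
  also have "\<dots> \<le> ru * norm (grad F x)" by (intro mult_right_mono ru) auto
  finally show ?thesis .
qed

end

section \<open>Thresholds for geometric and harmonic decay\<close>

text \<open>
  The time at which a geometric sequence falls below \<open>d\<close> is affine in \<open>ln (1 / d)\<close>; for
  \<open>d < 1 / 2\<close> the constant term is absorbed, as \<open>ln (1 / d)\<close> is then at least \<open>ln 2\<close>.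
\<close>

lemma log_threshold:
  fixes C q :: real
  assumes "0 < C" "0 < q" "q < 1"
  obtains N :: "real \<Rightarrow> nat" and C' where
    "\<And>d n. 0 < d \<Longrightarrow> N d \<le> n \<Longrightarrow> C * q ^ n \<le> d"
    "\<And>d. d \<in> {0<..<1/2} \<Longrightarrow> real (N d) \<le> C' * ln (1 / d)"
proof -
  define l where "l = ln (1 / q)"
  have l: "0 < l" using assms by (simp add: l_def ln_div)
  define N where "N d = nat \<lceil>ln (C / d) / l\<rceil>" for d
  define C' where "C' = (1 + \<bar>ln C\<bar> / ln 2) / l + 1 / ln 2"
  show thesis
  proof (rule that)
    fix d :: real and n assume d: "0 < d" and n: "N d \<le> n"
    have "ln (C / d) / l \<le> n" using n by (simp add: N_def nat_le_iff ceiling_le_iff)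
    then have "ln (C / d) \<le> ln ((1 / q) ^ n)"
      using l assms by (simp add: pos_divide_le_eq ln_realpow l_def del: power_one_over ln_div)
    then have "C / d \<le> (1 / q) ^ n" using assms d by simp
    then show "C * q ^ n \<le> d" using assms d by (simp add: field_simps)
  next
    fix d :: real assume "d \<in> {0<..<1/2}"
    then have d: "0 < d" "d < 1 / 2" by auto
    have "ln 2 \<le> ln (1 / d)" using d by (subst ln_le_cancel_iff) (auto simp: field_simps)
    then have ln2: "1 \<le> ln (1 / d) / ln 2" by simp
    have "ln C \<le> \<bar>ln C\<bar> * (ln (1 / d) / ln 2)"
      using mult_left_mono[OF ln2, of "\<bar>ln C\<bar>"] by simp
    moreover have "ln (C / d) = ln C + ln (1 / d)" using assms d by (simp add: ln_div)
    ultimately have "ln (C / d) / l \<le> (\<bar>ln C\<bar> * (ln (1 / d) / ln 2) + ln (1 / d)) / l"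
      using l by (intro divide_right_mono) auto
    moreover have "0 \<le> (\<bar>ln C\<bar> * (ln (1 / d) / ln 2) + ln (1 / d)) / l"
      using l d ln2 by (intro divide_nonneg_pos add_nonneg_nonneg mult_nonneg_nonneg) auto
    ultimately have "real (N d) \<le> (\<bar>ln C\<bar> * (ln (1 / d) / ln 2) + ln (1 / d)) / l + 1"
      unfolding N_def by linarith
    also have "\<dots> \<le> (\<bar>ln C\<bar> * (ln (1 / d) / ln 2) + ln (1 / d)) / l + ln (1 / d) / ln 2"
      using ln2 by simp
    also have "\<dots> = C' * ln (1 / d)" using l by (simp add: C'_def field_simps)
    finally show "real (N d) \<le> C' * ln (1 / d)" .
  qed
qed

text \<open>
  The discrete analogue of \<open>a' = - k a\<^sup>2\<close>, whose solutions are below \<open>1 / (k t)\<close>. With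
  \<open>b = k a\<^sub>n\<close>, the induction step rests on \<open>(n + 1) b (1 - b) \<le> (1 + b) (1 - b) \<le> 1\<close>, where the
  first inequality uses \<open>n b \<le> 1\<close> and \<open>b \<le> 1\<close>; for \<open>b > 1\<close> the left-hand side is negative.
\<close>

lemma quadratic_decay:
  fixes a :: "nat \<Rightarrow> real"
  assumes "0 < k" and "\<And>n. 0 \<le> a n" and step: "\<And>n. a (Suc n) \<le> a n - k * (a n)\<^sup>2"
  shows "k * n * a n \<le> 1"
proof (induction n)
  case (Suc n)
  define b where "b = k * a n"
  have nb: "real n * b \<le> 1" using Suc by (simp add: b_def mult_ac)
  have b0: "0 \<le> b" using assms by (simp add: b_def)
  have "k * a (Suc n) \<le> b * (1 - b)"
    using mult_left_mono[OF step, of k n] \<open>0 < k\<close>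
    by (simp add: b_def algebra_simps power2_eq_square)
  then have "k * Suc n * a (Suc n) \<le> Suc n * (b * (1 - b))"
    using mult_left_mono[of "k * a (Suc n)" "b * (1 - b)" "Suc n"] by (simp add: mult_ac)
  also have "\<dots> \<le> 1"
  proof (cases "b \<le> 1")
    case True
    have "real n * b * (1 - b) \<le> 1 * (1 - b)" using nb True by (intro mult_right_mono) auto
    then have "Suc n * (b * (1 - b)) \<le> (1 + b) * (1 - b)" by (simp add: algebra_simps)
    also have "\<dots> = 1 - b * b" by (simp add: algebra_simps)
    finally show ?thesis using zero_le_square[of b] by linarith
  next
    case False
    then have "Suc n * (b * (1 - b)) \<le> 0" using b0 by (intro mult_nonneg_nonpos) auto
    then show ?thesis by simp
  qed
  finally show ?case by simp
qed simp

section \<open>The standard Gaussian law\<close>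

lemma std_gaussian_density_measurable [measurable]:
  "std_gaussian_density \<in> borel_measurable (borel :: (real ^ 'd) measure)"
  unfolding std_gaussian_density_def[abs_def] by measurable

lemma std_gaussian_density_pos: "0 < std_gaussian_density x"
  unfolding std_gaussian_density_def by (intro prod_pos) (simp add: normal_density_pos)

lemma std_gaussian_density_eq_prod_Basis:
  fixes x :: "real ^ 'd"
  shows "std_gaussian_density x = (\<Prod>b\<in>Basis. std_normal_density (x \<bullet> b))"
proof -
  have *: "(Basis :: (real ^ 'd) set) = (\<lambda>i. axis i 1) ` UNIV"
    by (auto simp: Basis_vec_def)
  have inj: "inj (\<lambda>i::'d. axis i (1::real))" by (auto simp: inj_on_def axis_eq_axis)
  show ?thesis
    unfolding std_gaussian_density_def
    by (subst *, subst prod.reindex[OF inj]) (simp add: inner_axis)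
qed

lemma prob_space_std_gaussian:
  "prob_space (density lborel (std_gaussian_density :: real ^ 'd \<Rightarrow> real))"
proof
  have "(\<integral>\<^sup>+t. ennreal (std_normal_density t) \<partial>lborel) = 1"
    using prob_space.emeasure_space_1[OF prob_space_normal_density[of 1 0]]
    by (simp add: emeasure_density)
  then have "(\<integral>\<^sup>+z. (\<Prod>b\<in>Basis. ennreal (std_normal_density (z \<bullet> b))) \<partial>(lborel :: (real ^ 'd) measure)) = 1"
    by (subst nn_integral_lborel_prod) auto
  then show "emeasure (density lborel std_gaussian_density)
      (space (density lborel (std_gaussian_density :: real ^ 'd \<Rightarrow> real))) = 1"
    by (simp add: emeasure_density std_gaussian_density_eq_prod_Basis prod_ennreal)
qed

text \<open>
  The right-hand side is a product of functions of single coordinates, and so is the Gaussian density;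
  the bound reduces the second moment to a product of one-dimensional integrals.
\<close>

lemma norm_squared_le_prod: "(norm (x :: 'a :: euclidean_space))\<^sup>2 \<le> (\<Prod>b\<in>Basis. 1 + (x \<bullet> b)\<^sup>2)"
proof -
  have "1 + (\<Sum>b\<in>A. f b) \<le> (\<Prod>b\<in>A. 1 + f b)"
    if "finite A" "\<And>b. 0 \<le> f b" for A :: "'a set" and f :: "'a \<Rightarrow> real"
    using that
  proof (induction A rule: finite_induct)
    case (insert b A)
    then have le: "1 + (\<Sum>b\<in>A. f b) \<le> (\<Prod>b\<in>A. 1 + f b)" by simp
    have "f b * 1 \<le> f b * (1 + (\<Sum>b\<in>A. f b))"
      using insert.prems by (intro mult_left_mono) (auto intro: sum_nonneg)
    then have "1 + (f b + (\<Sum>b\<in>A. f b)) \<le> (1 + f b) * (1 + (\<Sum>b\<in>A. f b))"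
      by (simp add: algebra_simps)
    also have "\<dots> \<le> (1 + f b) * (\<Prod>b\<in>A. 1 + f b)"
      using insert.prems[of b] by (intro mult_left_mono le) auto
    finally show ?case using insert by simp
  qed simp
  from this[of Basis "\<lambda>b. (x \<bullet> b)\<^sup>2"] have "1 + (\<Sum>b\<in>Basis. (x \<bullet> b)\<^sup>2) \<le> (\<Prod>b\<in>Basis. 1 + (x \<bullet> b)\<^sup>2)"
    by simp
  moreover have "(norm x)\<^sup>2 = (\<Sum>b\<in>Basis. (x \<bullet> b)\<^sup>2)"
    unfolding power2_norm_eq_inner by (subst euclidean_inner) (simp add: power2_eq_square)
  ultimately show ?thesis by simp
qed

lemma std_gaussian_second_moment_finite:
  "(\<integral>\<^sup>+z. ennreal (std_gaussian_density z) * ennreal ((norm z)\<^sup>2) \<partial>(lborel :: (real ^ 'd) measure)) < \<infinity>"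
proof -
  let ?f = "\<lambda>t. std_normal_density t * (1 + t\<^sup>2)"
  have "integrable lborel ?f"
    using integrable_std_normal_moment[of 0] integrable_std_normal_moment[of 2]
    by (simp add: distrib_left)
  then have fin: "(\<integral>\<^sup>+t. ennreal (?f t) \<partial>lborel) < \<infinity>"
    by (subst nn_integral_eq_integral) auto
  have "(\<integral>\<^sup>+z. ennreal (std_gaussian_density z) * ennreal ((norm z)\<^sup>2) \<partial>(lborel :: (real ^ 'd) measure))
      \<le> (\<integral>\<^sup>+z. (\<Prod>b\<in>Basis. ennreal (?f (z \<bullet> b))) \<partial>(lborel :: (real ^ 'd) measure))"
  proof (intro nn_integral_mono)
    fix z :: "real ^ 'd"
    have "std_gaussian_density z * (norm z)\<^sup>2
        \<le> (\<Prod>b\<in>Basis. std_normal_density (z \<bullet> b)) * (\<Prod>b\<in>Basis. 1 + (z \<bullet> b)\<^sup>2)"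
      unfolding std_gaussian_density_eq_prod_Basis
      by (intro mult_left_mono norm_squared_le_prod prod_nonneg) auto
    then show "ennreal (std_gaussian_density z) * ennreal ((norm z)\<^sup>2)
        \<le> (\<Prod>b\<in>Basis. ennreal (?f (z \<bullet> b)))"
      using std_gaussian_density_pos[of z]
      by (simp add: prod_ennreal prod.distrib ennreal_leI flip: ennreal_mult')
  qed
  also have "\<dots> = (\<Prod>b\<in>(Basis :: (real ^ 'd) set). \<integral>\<^sup>+t. ennreal (?f t) \<partial>lborel)"
    by (rule nn_integral_lborel_prod) auto
  also have "\<dots> < \<infinity>"
    using fin by (simp add: power_less_top_ennreal)
  finally show ?thesis .
qed

text \<open>
  All the balls lie in one compact ball, on which the density, being continuous and positive, is bounded below.
  The Lebesgue measure of a ball does not depend on its centre.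
\<close>

lemma std_gaussian_ball_prob:
  assumes "0 < \<rho>"
  obtains p where "0 < p" "\<And>c. norm c \<le> r \<Longrightarrow>
    ennreal p \<le> emeasure (density lborel (std_gaussian_density :: real ^ 'd \<Rightarrow> real)) (ball c \<rho>)"
proof -
  let ?K = "cball 0 (r + \<rho>) :: (real ^ 'd) set"
  have "\<exists>\<alpha>>0. \<forall>z\<in>?K. \<alpha> \<le> std_gaussian_density z"
  proof (cases "?K = {}")
    case False
    have "continuous_on ?K std_gaussian_density"
      unfolding std_gaussian_density_def[abs_def] std_normal_density_def by (intro continuous_intros) auto
    from continuous_attains_inf[OF compact_cball False this] show ?thesis
      using std_gaussian_density_pos by blast
  qed (auto intro: exI[of _ 1])
  then obtain \<alpha> where \<alpha>: "0 < \<alpha>" "\<And>z. z \<in> ?K \<Longrightarrow> \<alpha> \<le> std_gaussian_density z" by blast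
  define p where "p = \<alpha> * measure lborel (ball (0 :: real ^ 'd) \<rho>)"
  show thesis
  proof (rule that)
    show "0 < p" using \<alpha> content_ball_pos[OF assms] by (simp add: p_def)
  next
    fix c :: "real ^ 'd" assume c: "norm c \<le> r"
    have "ennreal p = ennreal \<alpha> * emeasure lborel (ball c \<rho>)"
      using \<alpha> assms emeasure_lborel_ball_finite[of c \<rho>]
      by (simp add: p_def ennreal_mult emeasure_eq_ennreal_measure content_ball)
    also have "\<dots> = (\<integral>\<^sup>+z. ennreal \<alpha> * indicator (ball c \<rho>) z \<partial>lborel)"
      by (simp add: nn_integral_cmult_indicator)
    also have "\<dots> \<le> (\<integral>\<^sup>+z. ennreal (std_gaussian_density z) * indicator (ball c \<rho>) z \<partial>lborel)"
    proof (intro nn_integral_mono)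
      fix z
      show "ennreal \<alpha> * indicator (ball c \<rho>) z
        \<le> ennreal (std_gaussian_density z) * indicator (ball c \<rho>) z"
      proof (cases "z \<in> ball c \<rho>")
        case True
        then have "norm z \<le> r + \<rho>"
          using c norm_triangle_ineq[of c "z - c"] by (simp add: dist_norm norm_minus_commute)
        then show ?thesis using \<alpha>(2)[of z] True by (simp add: ennreal_leI)
      qed simp
    qed
    also have "\<dots> = emeasure (density lborel std_gaussian_density) (ball c \<rho>)"
      by (subst emeasure_density) auto
    finally show "ennreal p \<le> emeasure (density lborel (std_gaussian_density :: real ^ 'd \<Rightarrow> real)) (ball c \<rho>)" .
  qed
qed

section \<open>Recursions driven by i.i.d. noise\<close>

text \<open>
  Foster-Lyapunov iteration for \<open>S\<^sub>n\<^sub>+\<^sub>1 = step S\<^sub>n Z\<^sub>n\<close>. The state \<open>S\<^sub>n\<close> is a function of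
  the noise before time \<open>n\<close>, hence independent of \<open>Z\<^sub>n\<close>; Fubini then allows the one-step contraction to be applied
  for each fixed value of the state. Contraction is required only on an invariant set \<open>I\<close> of states.
\<close>

lemma (in prob_space) iid_recursion_contracts:
  fixes Z :: "nat \<Rightarrow> 'a \<Rightarrow> 'z" and S :: "nat \<Rightarrow> 'a \<Rightarrow> 's" and W :: "'s \<Rightarrow> ennreal"
  assumes indep: "indep_vars (\<lambda>_. N) Z UNIV"
    and law: "\<And>n. distr M N (Z n) = \<nu>"
    and step [measurable]: "case_prod step \<in> measurable (E \<Otimes>\<^sub>M N) E"
    and W [measurable]: "W \<in> borel_measurable E"
    and s0: "s0 \<in> space E"
    and S_0: "\<And>\<omega>. S 0 \<omega> = s0" and S_Suc: "\<And>n \<omega>. S (Suc n) \<omega> = step (S n \<omega>) (Z n \<omega>)"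
    and inv: "\<And>n \<omega>. I (S n \<omega>)"
    and contract: "\<And>s. I s \<Longrightarrow> (\<integral>\<^sup>+z. W (step s z) \<partial>\<nu>) \<le> q * W s"
  shows "S n \<in> measurable M E" "(\<integral>\<^sup>+\<omega>. W (S n \<omega>) \<partial>M) \<le> q ^ n * W s0"
proof -
  have Z [measurable]: "Z n \<in> measurable M N" for n
    using indep by (auto simp: indep_vars_def)
  have S [measurable]: "S n \<in> measurable M E" for n
  proof (induction n)
    case 0
    then show ?case using s0 by (simp add: S_0[abs_def])
  next
    case (Suc n)
    note Suc[measurable]
    have "(\<lambda>\<omega>. case_prod step (S n \<omega>, Z n \<omega>)) \<in> measurable M E" by measurable
    then show ?case by (simp add: S_Suc[abs_def])
  qed
  show "S n \<in> measurable M E" by (rule S)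
  have past: "\<exists>g. g \<in> measurable (PiM {..<n} (\<lambda>_. N)) E \<and>
      (\<forall>\<omega>\<in>space M. S n \<omega> = g (\<lambda>i\<in>{..<n}. Z i \<omega>))" for n
  proof (induction n)
    case 0
    then show ?case using s0 by (intro exI[of _ "\<lambda>_. s0"]) (simp add: S_0)
  next
    case (Suc n)
    then obtain g where g [measurable]: "g \<in> measurable (PiM {..<n} (\<lambda>_. N)) E"
      and S: "\<And>\<omega>. \<omega> \<in> space M \<Longrightarrow> S n \<omega> = g (\<lambda>i\<in>{..<n}. Z i \<omega>)" by blast
    let ?g = "\<lambda>z. case_prod step (g (restrict z {..<n}), z n)"
    have "(\<lambda>z. restrict z {..<n}) \<in> measurable (PiM {..<Suc n} (\<lambda>_. N)) (PiM {..<n} (\<lambda>_. N))"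
      by (rule measurable_restrict_subset) auto
    then have "?g \<in> measurable (PiM {..<Suc n} (\<lambda>_. N)) E" by measurable
    moreover have "S (Suc n) \<omega> = ?g (\<lambda>i\<in>{..<Suc n}. Z i \<omega>)" if "\<omega> \<in> space M" for \<omega>
      using S[OF that] by (simp add: S_Suc restrict_def cong: if_cong)
    ultimately show ?case by blast
  qed
  show "(\<integral>\<^sup>+\<omega>. W (S n \<omega>) \<partial>M) \<le> q ^ n * W s0"
  proof (induction n)
    case 0
    then show ?case by (simp add: S_0 emeasure_space_1)
  next
    case (Suc n)
    let ?past = "\<lambda>\<omega>. \<lambda>i\<in>{..<n}. Z i \<omega>" and ?now = "\<lambda>\<omega>. \<lambda>i\<in>{n}. Z i \<omega>"
    let ?A = "PiM {..<n} (\<lambda>_. N)" and ?B = "PiM {n} (\<lambda>_. N)"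
    obtain g where g [measurable]: "g \<in> measurable ?A E"
      and S_eq: "\<And>\<omega>. \<omega> \<in> space M \<Longrightarrow> S n \<omega> = g (?past \<omega>)" using past by blast
    have "indep_var ?A ?past ?B ?now"
      using indep by (rule indep_var_restrict) auto
    then have [measurable]: "?past \<in> measurable M ?A" "?now \<in> measurable M ?B"
      and prod: "distr M (?A \<Otimes>\<^sub>M ?B) (\<lambda>\<omega>. (?past \<omega>, ?now \<omega>)) = distr M ?A ?past \<Otimes>\<^sub>M distr M ?B ?now"
      unfolding indep_var_distribution_eq by auto
    interpret now: prob_space "distr M ?B ?now"
      by (rule prob_space_distr) measurable
    define G where "G = (\<lambda>ab. W (case_prod step (g (fst ab), snd ab n)))"
    have G [measurable]: "G \<in> borel_measurable (?A \<Otimes>\<^sub>M ?B)"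
      unfolding G_def by measurable
    have inner: "(\<integral>\<^sup>+b. G (a, b) \<partial>distr M ?B ?now) = (\<integral>\<^sup>+z. W (step (g a) z) \<partial>\<nu>)"
      if a: "a \<in> space ?A" for a
    proof -
      have ga: "g a \<in> space E" using g a by (rule measurable_space)
      then have W_step: "(\<lambda>z. W (case_prod step (g a, z))) \<in> borel_measurable N" by measurable
      have "(\<integral>\<^sup>+b. G (a, b) \<partial>distr M ?B ?now) = (\<integral>\<^sup>+\<omega>. G (a, ?now \<omega>) \<partial>M)"
        using a by (intro nn_integral_distr) measurable
      also have "\<dots> = (\<integral>\<^sup>+\<omega>. W (case_prod step (g a, Z n \<omega>)) \<partial>M)"
        by (simp add: G_def)
      also have "\<dots> = (\<integral>\<^sup>+z. W (case_prod step (g a, z)) \<partial>distr M N (Z n))"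
        by (rule nn_integral_distr[symmetric]) (use W_step in auto)
      finally show ?thesis by (simp add: law)
    qed
    have "(\<integral>\<^sup>+\<omega>. W (S (Suc n) \<omega>) \<partial>M) = (\<integral>\<^sup>+\<omega>. G (?past \<omega>, ?now \<omega>) \<partial>M)"
      by (intro nn_integral_cong) (simp add: S_Suc S_eq G_def)
    also have "\<dots> = (\<integral>\<^sup>+ab. G ab \<partial>(distr M ?A ?past \<Otimes>\<^sub>M distr M ?B ?now))"
      unfolding prod[symmetric] by (rule nn_integral_distr[symmetric]) measurable
    also have "\<dots> = (\<integral>\<^sup>+a. (\<integral>\<^sup>+b. G (a, b) \<partial>distr M ?B ?now) \<partial>distr M ?A ?past)"
      by (rule now.nn_integral_fst[symmetric]) measurable
    also have "\<dots> = (\<integral>\<^sup>+\<omega>. (\<integral>\<^sup>+b. G (?past \<omega>, b) \<partial>distr M ?B ?now) \<partial>M)"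
      by (rule nn_integral_distr) measurable
    also have "\<dots> = (\<integral>\<^sup>+\<omega>. (\<integral>\<^sup>+z. W (step (S n \<omega>) z) \<partial>\<nu>) \<partial>M)"
      by (intro nn_integral_cong) (simp add: S_eq inner measurable_space[of ?past M ?A])
    also have "\<dots> \<le> (\<integral>\<^sup>+\<omega>. q * W (S n \<omega>) \<partial>M)"
      by (intro nn_integral_mono contract inv)
    also have "\<dots> = q * (\<integral>\<^sup>+\<omega>. W (S n \<omega>) \<partial>M)"
      by (rule nn_integral_cmult) measurable
    also have "\<dots> \<le> q * (q ^ n * W s0)" by (intro mult_left_mono Suc) auto
    finally show ?case by (simp add: mult.assoc)
  qed
qed

section \<open>Capture of X by the sub-level set\<close>

definition advance ::
  "algorithm \<Rightarrow> (real ^ 'd \<Rightarrow> real) \<Rightarrow> real \<Rightarrow> real \<Rightarrow> real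
    \<Rightarrow> (real ^ 'd) \<times> (real ^ 'd) \<Rightarrow> real ^ 'd \<Rightarrow> (real ^ 'd) \<times> (real ^ 'd)" where
  "advance alg F \<gamma> h t0 s z =
    (let x' = fst s - h *\<^sub>R grad F (fst s);
         y' = snd s - h *\<^sub>R grad F (snd s) + sqrt (2 * \<gamma> * h) *\<^sub>R z
     in if F y' < F x' - t0
        then (if alg = GDxLD then (y', x') else (y', y'))
        else (x', y'))"

lemma iterates_Suc_eq_advance:
  "iterates alg F \<gamma> h t0 x0 y0 z (Suc n) = advance alg F \<gamma> h t0 (iterates alg F \<gamma> h t0 x0 y0 z n) (z n)"
  by (cases alg) (auto simp: advance_def Let_def split: prod.split)

context smooth_minimisation
begin

lemma measurable_advance:
  "case_prod (advance alg F \<gamma> h t0) \<in> measurable ((borel \<Otimes>\<^sub>M borel) \<Otimes>\<^sub>M borel) (borel \<Otimes>\<^sub>M borel)"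
  unfolding advance_def[abs_def] Let_def case_prod_beta' by measurable

lemma F_fst_advance_le:
  assumes "0 \<le> t0"
  shows "F (fst (advance alg F \<gamma> h t0 s z)) \<le> F (fst s) - h / 2 * (norm (grad F (fst s)))\<^sup>2"
  using gradient_step[of "fst s"] assms by (auto simp: advance_def Let_def)

lemma F_fst_advance_le_self:
  assumes "0 \<le> t0"
  shows "F (fst (advance alg F \<gamma> h t0 s z)) \<le> F (fst s)"
  using gradient_step_le[of "fst s"] assms by (auto simp: advance_def Let_def)

text \<open>
  The second component is either the Langevin proposal or, after a GDxLD swap, the gradient step of the
  first one.
  Excesses over the minimum being nonnegative, the sum bounds both. The second summand never exceeds
  its initial value, so that swaps do not spoil the drift.
\<close>

lemma F_snd_advance_le:
  "F (snd (advance alg F \<gamma> h t0 s z)) - F xs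
     \<le> (F (snd s - h *\<^sub>R grad F (snd s) + sqrt (2 * \<gamma> * h) *\<^sub>R z) - F xs) + (F (fst s) - F xs)"
  using gradient_step_le[of "fst s"] min_le[of "fst s"]
    min_le[of "snd s - h *\<^sub>R grad F (snd s) + sqrt (2 * \<gamma> * h) *\<^sub>R z"]
  by (auto simp: advance_def Let_def)

text \<open>
  If no swap takes place, the gradient step was at most \<open>t0\<close> worse than the proposal. This is where the
  threshold enters: a proposal deep enough in the sub-level set brings the first component into it
  whether or not the swap happens.
\<close>

lemma F_fst_advance_le_proposal:
  assumes "0 \<le> t0"
  shows "F (fst (advance alg F \<gamma> h t0 s z))
    \<le> F (snd s - h *\<^sub>R grad F (snd s) + sqrt (2 * \<gamma> * h) *\<^sub>R z) + t0"
  using assms by (auto simp: advance_def Let_def)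

text \<open>
  Coercivity turns the decrease in terms of the gradient into a decrease proportional to the excess.
  The rate \<open>a\<close> is capped at \<open>1 / 2\<close> only to keep \<open>1 - a\<close> positive.
\<close>

lemma langevin_drift:
  assumes "coercive_assm F" "0 < \<gamma>"
  obtains a B c where "0 < a" "a \<le> 1 / 2" "0 \<le> B" "0 \<le> c"
    "\<And>y z. F (y - h *\<^sub>R grad F y + sqrt (2 * \<gamma> * h) *\<^sub>R z) - F xs
      \<le> (1 - a) * (F y - F xs) + B + c * (norm z)\<^sup>2"
proof -
  from assms obtain lc Mc where lc: "0 < lc" "\<And>x. (norm (grad F x))\<^sup>2 \<ge> lc * F x - Mc"
    unfolding coercive_assm_def by blast
  define a where "a = min (h * lc / 4) (1 / 2)"
  define B where "B = h / 4 * \<bar>lc * F xs - Mc\<bar>"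
  define c where "c = (L + 9 / (4 * h)) * (2 * \<gamma> * h)"
  show thesis
  proof (rule that)
    show "0 < a" "a \<le> 1 / 2" "0 \<le> B" "0 \<le> c"
      using lc step_pos L_pos assms by (auto simp: a_def B_def c_def)
  next
    fix y z :: "real ^ 'd"
    let ?u = "sqrt (2 * \<gamma> * h) *\<^sub>R z"
    have "lc * (F y - F xs) - \<bar>lc * F xs - Mc\<bar> \<le> (norm (grad F y))\<^sup>2"
      using lc(2)[of y] by (simp add: right_diff_distrib abs_if)
    then have "h / 4 * (lc * (F y - F xs) - \<bar>lc * F xs - Mc\<bar>) \<le> h / 4 * (norm (grad F y))\<^sup>2"
      using step_pos by (intro mult_left_mono) auto
    moreover have "a * (F y - F xs) \<le> h * lc / 4 * (F y - F xs)"
      using min_le[of y] by (intro mult_right_mono) (auto simp: a_def)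
    ultimately have "a * (F y - F xs) - B \<le> h / 4 * (norm (grad F y))\<^sup>2"
      by (simp add: B_def algebra_simps)
    moreover have "(L + 9 / (4 * h)) * (norm ?u)\<^sup>2 = c * (norm z)\<^sup>2"
      using step_pos assms by (simp add: c_def power_mult_distrib)
    ultimately show "F (y - h *\<^sub>R grad F y + ?u) - F xs \<le> (1 - a) * (F y - F xs) + B + c * (norm z)\<^sup>2"
      using noisy_gradient_step[of y ?u] by (simp add: left_diff_distrib)
  qed
qed

text \<open>
  From a bounded set of states, and sub-level sets are bounded by coercivity, the noise that moves the proposal
  into a fixed small ball about the minimiser fills a ball of fixed radius with bounded centre.
\<close>

lemma langevin_minorisation:
  assumes "coercive_assm F" "0 < \<gamma>" "0 < \<eta>"
  obtains p where "0 < p"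
    "\<And>y. F y \<le> R \<Longrightarrow> \<exists>A\<in>sets borel. ennreal p \<le> emeasure (density lborel std_gaussian_density) A \<and>
      (\<forall>z\<in>A. F (y - h *\<^sub>R grad F y + sqrt (2 * \<gamma> * h) *\<^sub>R z) \<le> F xs + \<eta>)"
proof -
  define \<sigma> where "\<sigma> = sqrt (2 * \<gamma> * h)"
  have \<sigma>: "0 < \<sigma>" using assms step_pos by (simp add: \<sigma>_def)
  have "\<forall>\<^sub>F y in at_infinity. R < F y"
    using assms by (simp add: coercive_assm_def filterlim_at_top_dense)
  then obtain b where b: "\<And>y. b \<le> norm y \<Longrightarrow> R < F y"
    unfolding eventually_at_infinity by blast
  have "continuous (at xs) F"
    using continuous_F[of UNIV] by (simp add: continuous_on_eq_continuous_at)
  then obtain \<rho> where \<rho>: "0 < \<rho>" "\<And>u. dist u xs < \<rho> \<Longrightarrow> F u \<le> F xs + \<eta>"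
    using \<open>0 < \<eta>\<close> unfolding continuous_at_eps_delta dist_real_def
    by (metis abs_le_D1 add.commute diff_le_eq less_imp_le)
  define r where "r = (norm xs + (b + h * (L * (b + norm xs)))) / \<sigma>"
  from \<sigma> \<rho>(1) have "0 < \<rho> / \<sigma>" by simp
  then obtain p where p: "0 < p" "\<And>c :: real ^ 'd. norm c \<le> r \<Longrightarrow>
      ennreal p \<le> emeasure (density lborel std_gaussian_density) (ball c (\<rho> / \<sigma>))"
    using std_gaussian_ball_prob[of "\<rho> / \<sigma>" r] by metis
  show thesis
  proof (rule that[OF p(1)])
    fix y assume "F y \<le> R"
    then have y: "norm y \<le> b" using b[of y] by linarith
    define w where "w = y - h *\<^sub>R grad F y"
    \<comment> \<open>The noise that moves the proposal exactly to the minimiser.\<close>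
    define c where "c = (1 / \<sigma>) *\<^sub>R (xs - w)"
    have "norm (grad F y) \<le> L * norm (y - xs)"
      using grad_lipschitz[of y xs] by (simp add: grad_minimum)
    also have "\<dots> \<le> L * (b + norm xs)"
      using L_pos y norm_triangle_ineq4[of y xs] by (intro mult_left_mono) auto
    finally have "h * norm (grad F y) \<le> h * (L * (b + norm xs))"
      using step_pos by (intro mult_left_mono) auto
    moreover have "norm w \<le> norm y + h * norm (grad F y)"
      using norm_triangle_ineq4[of y "h *\<^sub>R grad F y"] step_pos by (simp add: w_def)
    ultimately have "norm w \<le> b + h * (L * (b + norm xs))" using y by linarith
    then have c: "norm c \<le> r"
      using \<sigma> norm_triangle_ineq4[of xs w] by (simp add: c_def r_def divide_right_mono)
    have "F (w + \<sigma> *\<^sub>R z) \<le> F xs + \<eta>" if "z \<in> ball c (\<rho> / \<sigma>)" for z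
    proof (rule \<rho>(2))
      have "w + \<sigma> *\<^sub>R z - xs = \<sigma> *\<^sub>R (z - c)"
        using \<sigma> by (simp add: c_def scaleR_right_diff_distrib)
      then have "dist (w + \<sigma> *\<^sub>R z) xs = \<sigma> * dist c z"
        using \<sigma> by (simp add: dist_norm norm_minus_commute)
      then show "dist (w + \<sigma> *\<^sub>R z) xs < \<rho>"
        using that \<sigma> by (simp add: field_simps)
    qed
    then show "\<exists>A\<in>sets borel. ennreal p \<le> emeasure (density lborel std_gaussian_density) A \<and>
      (\<forall>z\<in>A. F (y - h *\<^sub>R grad F y + sqrt (2 * \<gamma> * h) *\<^sub>R z) \<le> F xs + \<eta>)"
      using p(2)[OF c] by (intro bexI[of _ "ball c (\<rho> / \<sigma>)"]) (auto simp: w_def \<sigma>_def)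
  qed
qed

text \<open>
  The Lyapunov function of the excess of \<open>Y\<close>, killed once \<open>X\<close> has entered the sub-level set. The
  constant \<open>K\<close> is the reward for being killed; it also makes the expectation dominate the probability
  of not having been killed yet.
\<close>

definition lyapunov :: "real \<Rightarrow> real \<Rightarrow> (real ^ 'd) \<times> (real ^ 'd) \<Rightarrow> ennreal" where
  "lyapunov r0 K s = (if F (fst s) \<le> F xs + r0 then 0 else ennreal (F (snd s) - F xs + K))"

lemma measurable_lyapunov: "lyapunov r0 K \<in> borel_measurable (borel \<Otimes>\<^sub>M borel)"
  unfolding lyapunov_def[abs_def] by measurable

text \<open>
  Drift and minorisation combine into a one-step contraction. If the excess of \<open>Y\<close> is above a level \<open>R\<close>, the drift
  outweighs the additive error \<open>b\<close>. Below \<open>R\<close>, the process is killed with probability at least \<open>p\<close>, and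
  \<open>K\<close> is chosen so large that the expected loss \<open>p K\<close> outweighs \<open>b\<close>. The bound \<open>v0\<close> on the excess
  of \<open>X\<close> is preserved along the iteration.
\<close>

lemma lyapunov_contraction:
  assumes "coercive_assm F" "0 < \<gamma>" "0 \<le> t0" "t0 \<le> r0 / 8" "0 < r0" "0 \<le> v0"
  obtains K q where "0 < K" "0 < q" "q < 1"
    "\<And>s. F (fst s) - F xs \<le> v0 \<Longrightarrow>
      (\<integral>\<^sup>+z. lyapunov r0 K (advance alg F \<gamma> h t0 s z) \<partial>density lborel std_gaussian_density)
        \<le> ennreal q * lyapunov r0 K s"
proof -
  let ?\<nu> = "density lborel (std_gaussian_density :: real ^ 'd \<Rightarrow> real)"
  interpret \<nu>: prob_space ?\<nu> by (rule prob_space_std_gaussian)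
  obtain a B c where a: "0 < a" "a \<le> 1 / 2" and B: "0 \<le> B" and c: "0 \<le> c"
    and drift: "\<And>y z. F (y - h *\<^sub>R grad F y + sqrt (2 * \<gamma> * h) *\<^sub>R z) - F xs
      \<le> (1 - a) * (F y - F xs) + B + c * (norm z)\<^sup>2"
    using langevin_drift[OF assms(1,2)] by metis
  define m2 where "m2 = enn2real (\<integral>\<^sup>+z. ennreal ((norm z)\<^sup>2) \<partial>?\<nu>)"
  have m2: "(\<integral>\<^sup>+z. ennreal ((norm z)\<^sup>2) \<partial>?\<nu>) = ennreal m2" "0 \<le> m2"
    using std_gaussian_second_moment_finite[where 'd = 'd]
    by (auto simp: m2_def nn_integral_density)
  define b where "b = B + v0 + c * m2 + 1"
  have b: "0 < b" using B assms c m2 by (simp add: b_def add_nonneg_pos)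
  \<comment> \<open>\<open>R\<close> and, below, \<open>K\<close> make the gain at least \<open>2 * b\<close> in either regime: \<open>a * V / 2\<close> above \<open>R\<close>, and \<open>p * K\<close> below.\<close>
  define R where "R = 4 * b / a"
  obtain p where p: "0 < p" and hit:
    "\<And>y. F y \<le> F xs + R \<Longrightarrow> \<exists>A\<in>sets borel. ennreal p \<le> emeasure ?\<nu> A \<and>
      (\<forall>z\<in>A. F (y - h *\<^sub>R grad F y + sqrt (2 * \<gamma> * h) *\<^sub>R z) \<le> F xs + r0 / 4)"
    using langevin_minorisation[of \<gamma> "r0 / 4" "F xs + R"] assms by auto
  define K where "K = 2 * b / p"
  have K: "0 < K" using b p by (simp add: K_def)
  define q where "q = max (1 - a / 2) (1 - b / K)"
  show thesis
  proof (rule that[OF K])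
    show "0 < q" using a by (simp add: q_def less_max_iff_disj)
    show "q < 1" using a b K by (simp add: q_def)
  next
    fix s :: "(real ^ 'd) \<times> (real ^ 'd)"
    assume v0: "F (fst s) - F xs \<le> v0"
    define V where "V = F (snd s) - F xs"
    have V: "0 \<le> V" using min_le by (simp add: V_def)
    let ?next = "\<lambda>z. advance alg F \<gamma> h t0 s z"
    let ?prop = "\<lambda>z. snd s - h *\<^sub>R grad F (snd s) + sqrt (2 * \<gamma> * h) *\<^sub>R z"
    show "(\<integral>\<^sup>+z. lyapunov r0 K (?next z) \<partial>?\<nu>) \<le> ennreal q * lyapunov r0 K s"
    proof (cases "F (fst s) \<le> F xs + r0")
      case True
      have "F (fst (?next z)) \<le> F xs + r0" for z
        using F_fst_advance_le_self[OF \<open>0 \<le> t0\<close>] True by (rule order_trans)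
      then show ?thesis by (simp add: lyapunov_def)
    next
      case False
      \<comment> \<open>Treats both regimes at once: above \<open>R\<close> the guaranteed hitting probability is \<open>0\<close>.\<close>
      define p' where "p' = (if V \<le> R then p else 0)"
      have "\<exists>A\<in>sets borel. ennreal p' \<le> emeasure ?\<nu> A \<and> (\<forall>z\<in>A. F (?prop z) \<le> F xs + r0 / 4)"
      proof (cases "V \<le> R")
        case True
        then show ?thesis using hit[of "snd s"] by (simp add: p'_def V_def)
      next
        case False
        then show ?thesis by (intro bexI[of _ "{}"]) (auto simp: p'_def)
      qed
      then obtain A where [measurable]: "A \<in> sets borel" and A: "ennreal p' \<le> emeasure ?\<nu> A"
        and near: "\<And>z. z \<in> A \<Longrightarrow> F (?prop z) \<le> F xs + r0 / 4" by blast
      have p'_le: "p' \<le> measure ?\<nu> A"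
        using A by (simp add: \<nu>.emeasure_eq_measure)
      have "emeasure ?\<nu> (- A) = ennreal (1 - measure ?\<nu> A)"
        using \<nu>.prob_compl[of A] by (simp add: \<nu>.emeasure_eq_measure Compl_eq_Diff_UNIV)
      also have "\<dots> \<le> ennreal (1 - p')" using p'_le by (intro ennreal_leI) simp
      finally have miss: "emeasure ?\<nu> (- A) \<le> ennreal (1 - p')" .
      have p'_le_1: "p' \<le> 1" using p'_le \<nu>.prob_le_1 by (rule order_trans)
      define e where "e = v0 + (1 - a) * V + B"
      have e: "0 \<le> e" using assms a V B by (simp add: e_def)
      have "lyapunov r0 K (?next z)
          \<le> ennreal e + ennreal c * ennreal ((norm z)\<^sup>2) + ennreal K * indicator (- A) z" for z
      proof (cases "z \<in> A")
        case True
        have "F (fst (?next z)) \<le> F xs + r0"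
          using F_fst_advance_le_proposal[OF \<open>0 \<le> t0\<close>, of alg \<gamma> s z] near[OF True] assms by simp
        then show ?thesis by (simp add: lyapunov_def)
      next
        case False
        have "F (snd (?next z)) - F xs + K \<le> e + c * (norm z)\<^sup>2 + K"
          using F_snd_advance_le[of alg \<gamma> t0 s z] drift[of "snd s" z] v0
          by (simp add: e_def V_def)
        then have "lyapunov r0 K (?next z) \<le> ennreal (e + c * (norm z)\<^sup>2 + K)"
          unfolding lyapunov_def by (auto intro: ennreal_leI)
        also have "\<dots> = ennreal e + ennreal c * ennreal ((norm z)\<^sup>2) + ennreal K * indicator (- A) z"
          using False e c K by (simp add: ennreal_plus ennreal_mult)
        finally show ?thesis .
      qed
      then have "(\<integral>\<^sup>+z. lyapunov r0 K (?next z) \<partial>?\<nu>)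
          \<le> (\<integral>\<^sup>+z. ennreal e + ennreal c * ennreal ((norm z)\<^sup>2) + ennreal K * indicator (- A) z \<partial>?\<nu>)"
        by (intro nn_integral_mono)
      also have "\<dots> = ennreal e + ennreal c * ennreal m2 + ennreal K * emeasure ?\<nu> (- A)"
        using \<nu>.emeasure_space_1
        by (simp add: nn_integral_add nn_integral_cmult m2 nn_integral_cmult_indicator)
      also have "\<dots> \<le> ennreal e + ennreal c * ennreal m2 + ennreal K * ennreal (1 - p')"
        by (intro add_left_mono mult_left_mono miss) auto
      also have "\<dots> = ennreal (e + c * m2 + K * (1 - p'))"
        using e c m2 K p'_le_1 by (simp add: ennreal_plus ennreal_mult)
      also have "\<dots> \<le> ennreal (q * (V + K))"
      proof (rule ennreal_leI)
        have "e + c * m2 + K * (1 - p') \<le> (1 - a) * V + b + K - K * p'"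
          by (simp add: e_def b_def algebra_simps)
        also have "\<dots> \<le> (1 - a / 2) * V + K - b"
        proof (cases "V \<le> R")
          case True
          have "K * p' = 2 * b" using True p by (simp add: K_def p'_def)
          moreover have "0 \<le> a * V" using a V by simp
          ultimately show ?thesis by (simp add: algebra_simps)
        next
          case False
          then have "4 * b \<le> a * V" using a by (simp add: R_def field_simps)
          then show ?thesis using False b by (simp add: p'_def algebra_simps)
        qed
        also have "\<dots> = (1 - a / 2) * V + (1 - b / K) * K" using K by (simp add: field_simps)
        also have "\<dots> \<le> q * V + q * K"
          using V K by (intro add_mono mult_right_mono) (auto simp: q_def)
        finally show "e + c * m2 + K * (1 - p') \<le> q * (V + K)" by (simp add: algebra_simps)
      qed
      also have "\<dots> = ennreal q * lyapunov r0 K s"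
        using False V K a by (simp add: lyapunov_def V_def ennreal_mult' q_def)
      finally show ?thesis .
    qed
  qed
qed

text \<open>
  Iterating the contraction and applying Markov's inequality, the probability that \<open>X\<close> is still outside the sub-level
  set decays geometrically.
\<close>

lemma captured_with_high_probability:
  fixes X Y :: "nat \<Rightarrow> 'w \<Rightarrow> real ^ 'd"
  assumes "coercive_assm F" "prob_space P" "iid_std_gaussian P Z" "0 < \<gamma>"
    and XY: "\<And>n \<omega>. (X n \<omega>, Y n \<omega>) = iterates alg F \<gamma> h t0 x0 y0 (\<lambda>k. Z k \<omega>) n"
    and t0: "0 \<le> t0" "t0 \<le> r0 / 8" and r0: "0 < r0"
  obtains T :: "real \<Rightarrow> nat" and C where
    "\<And>n. X n \<in> borel_measurable P"
    "\<And>\<delta> n. 0 < \<delta> \<Longrightarrow> T \<delta> \<le> n \<Longrightarrow> \<P>(\<omega> in P. F (X n \<omega>) \<le> F xs + r0) \<ge> 1 - \<delta>"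
    "\<And>\<delta>. \<delta> \<in> {0<..<1/2} \<Longrightarrow> real (T \<delta>) \<le> C * ln (1 / \<delta>)"
proof -
  interpret prob_space P by fact
  let ?\<nu> = "density lborel (std_gaussian_density :: real ^ 'd \<Rightarrow> real)"
  let ?S = "\<lambda>n \<omega>. (X n \<omega>, Y n \<omega>)"
  let ?E = "borel \<Otimes>\<^sub>M borel :: ((real ^ 'd) \<times> (real ^ 'd)) measure"
  have indep: "indep_vars (\<lambda>_. borel) Z UNIV"
    and dist: "\<And>n. distributed P lborel (Z n) (\<lambda>x. ennreal (std_gaussian_density x))"
    using assms by (auto simp: iid_std_gaussian_def)
  have law: "distr P borel (Z n) = ?\<nu>" for n
    using distributed_distr_eq_density[OF dist[of n]] distr_cong[of P P borel lborel "Z n" "Z n"]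
    by simp
  have S_Suc: "?S (Suc n) \<omega> = advance alg F \<gamma> h t0 (?S n \<omega>) (Z n \<omega>)" for n \<omega>
    unfolding XY iterates_Suc_eq_advance ..
  have S_0: "?S 0 \<omega> = (x0, y0)" for \<omega> unfolding XY by simp
  have inv: "F (fst (?S n \<omega>)) - F xs \<le> F x0 - F xs" for n \<omega>
  proof (induction n)
    case (Suc n)
    then show ?case
      unfolding S_Suc using F_fst_advance_le_self[OF t0(1), of alg \<gamma> "?S n \<omega>" "Z n \<omega>"] by simp
  qed (simp only: S_0 fst_conv)
  obtain K q where K: "0 < K" and q: "0 < q" "q < 1"
    and contract: "\<And>s. F (fst s) - F xs \<le> F x0 - F xs \<Longrightarrow>
      (\<integral>\<^sup>+z. lyapunov r0 K (advance alg F \<gamma> h t0 s z) \<partial>?\<nu>) \<le> ennreal q * lyapunov r0 K s"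
    using lyapunov_contraction[OF assms(1,4) t0 r0, of "F x0 - F xs" alg] min_le by auto
  note rec = iid_recursion_contracts[where S = ?S and I = "\<lambda>s. F (fst s) - F xs \<le> F x0 - F xs",
    OF indep law measurable_advance measurable_lyapunov _ S_0 S_Suc inv contract]
  have S_meas: "?S n \<in> measurable P ?E" for n
    by (rule rec(1)) (auto simp: space_pair_measure)
  have X [measurable]: "X n \<in> borel_measurable P" for n
    using measurable_compose[OF S_meas measurable_fst] by simp
  define C where "C = (F y0 - F xs + K) / K"
  have C: "0 < C" using K min_le[of y0] by (simp add: C_def)
  have tail: "prob {\<omega>\<in>space P. \<not> F (X n \<omega>) \<le> F xs + r0} \<le> C * q ^ n" for n
  proof -
    let ?A = "{\<omega>\<in>space P. \<not> F (X n \<omega>) \<le> F xs + r0}"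
    have "ennreal K * emeasure P ?A = (\<integral>\<^sup>+\<omega>. ennreal K * indicator ?A \<omega> \<partial>P)"
      by (subst nn_integral_cmult_indicator) auto
    also have "\<dots> \<le> (\<integral>\<^sup>+\<omega>. lyapunov r0 K (?S n \<omega>) \<partial>P)"
      using min_le by (intro nn_integral_mono) (auto simp: lyapunov_def indicator_def intro!: ennreal_leI)
    also have "\<dots> \<le> ennreal q ^ n * lyapunov r0 K (x0, y0)"
      by (rule rec(2)) (auto simp: space_pair_measure)
    also have "\<dots> \<le> ennreal q ^ n * ennreal (F y0 - F xs + K)"
      by (intro mult_left_mono) (auto simp: lyapunov_def)
    also have "\<dots> = ennreal K * ennreal (C * q ^ n)"
      using q K C by (simp add: ennreal_power C_def mult.commute flip: ennreal_mult')
    finally have "ennreal (K * prob ?A) \<le> ennreal (K * (C * q ^ n))"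
      using K C q by (simp add: emeasure_eq_measure ennreal_mult)
    then show ?thesis using K C q by simp
  qed
  obtain T C' where T: "\<And>d n. 0 < d \<Longrightarrow> T d \<le> n \<Longrightarrow> C * q ^ n \<le> d"
    "\<And>d. d \<in> {0<..<1/2} \<Longrightarrow> real (T d) \<le> C' * ln (1 / d)"
    using log_threshold[OF C q] by metis
  show thesis
  proof (rule that[OF X _ T(2)])
    fix \<delta> :: real and n assume "0 < \<delta>" "T \<delta> \<le> n"
    then have "prob {\<omega>\<in>space P. \<not> F (X n \<omega>) \<le> F xs + r0} \<le> \<delta>"
      using tail[of n] T(1) by (meson order_trans)
    then show "\<P>(\<omega> in P. F (X n \<omega>) \<le> F xs + r0) \<ge> 1 - \<delta>"
      by (subst (asm) prob_neg) auto
  qed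
qed

section \<open>From capture to complexity\<close>

text \<open>
  Once in the sub-level set \<open>X\<close> never leaves it, and swaps only lower \<open>F\<close>, so from there
  the excesses \<open>a\<^sub>j\<close> of \<open>X\<close> decrease deterministically, at least as fast as under gradient descent. If \<open>k \<epsilon>\<close> such steps
  bring the excess below \<open>\<epsilon>\<close>, it suffices to be captured \<open>k \<epsilon>\<close> steps before the time considered.
\<close>

lemma complexity_from_descent_rate:
  fixes X Y :: "nat \<Rightarrow> 'w \<Rightarrow> real ^ 'd"
  assumes "coercive_assm F" "prob_space P" "iid_std_gaussian P Z" "0 < \<gamma>"
    and XY: "\<And>n \<omega>. (X n \<omega>, Y n \<omega>) = iterates alg F \<gamma> h t0 x0 y0 (\<lambda>k. Z k \<omega>) n"
    and t0: "0 \<le> t0" "t0 \<le> r0 / 8" and r0: "0 < r0"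
    and rate: "\<And>a \<epsilon> n. (\<And>j. 0 \<le> a j) \<Longrightarrow> a 0 \<le> r0 \<Longrightarrow>
        (\<And>j. \<exists>x\<in>sublevel F xs r0. a j = F x - F xs \<and> a (Suc j) \<le> a j - h / 2 * (norm (grad F x))\<^sup>2) \<Longrightarrow>
        0 < \<epsilon> \<Longrightarrow> k \<epsilon> \<le> n \<Longrightarrow> a n \<le> \<epsilon>"
    and k: "\<And>\<epsilon>. \<epsilon> \<in> {0<..<1/2} \<Longrightarrow> real (k \<epsilon>) \<le> C1 * g \<epsilon>"
  shows "\<exists>N :: real \<Rightarrow> real \<Rightarrow> nat.
          (\<forall>\<epsilon>>0. \<forall>\<delta>>0. \<forall>n\<ge>N \<epsilon> \<delta>. \<P>(\<omega> in P. F (X n \<omega>) - F xs \<le> \<epsilon>) \<ge> 1 - \<delta>) \<and>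
          (\<exists>C1 C2. \<forall>\<epsilon>\<in>{0<..<1/2}. \<forall>\<delta>\<in>{0<..<1/2}.
             real (N \<epsilon> \<delta>) \<le> C1 * g \<epsilon> + C2 * ln (1 / \<delta>))"
proof -
  interpret prob_space P by fact
  obtain T C where X [measurable]: "\<And>n. X n \<in> borel_measurable P"
    and T: "\<And>\<delta> n. 0 < \<delta> \<Longrightarrow> T \<delta> \<le> n \<Longrightarrow> \<P>(\<omega> in P. F (X n \<omega>) \<le> F xs + r0) \<ge> 1 - \<delta>"
      "\<And>\<delta>. \<delta> \<in> {0<..<1/2} \<Longrightarrow> real (T \<delta>) \<le> C * ln (1 / \<delta>)"
    by (rule captured_with_high_probability[OF assms(1-8)]) (rule that; blast)
  have "F (fst (X (Suc n) \<omega>, Y (Suc n) \<omega>)) \<le> F (fst (X n \<omega>, Y n \<omega>))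
      - h / 2 * (norm (grad F (fst (X n \<omega>, Y n \<omega>))))\<^sup>2" for n \<omega>
    unfolding XY iterates_Suc_eq_advance by (rule F_fst_advance_le[OF t0(1)])
  then have descent: "F (X (Suc n) \<omega>) \<le> F (X n \<omega>) - h / 2 * (norm (grad F (X n \<omega>)))\<^sup>2" for n \<omega>
    by simp
  have reach: "F (X (m + n) \<omega>) - F xs \<le> \<epsilon>"
    if "F (X m \<omega>) \<le> F xs + r0" "0 < \<epsilon>" "k \<epsilon> \<le> n" for m n \<epsilon> \<omega>
  proof (rule rate[where a = "\<lambda>j. F (X (m + j) \<omega>) - F xs"])
    fix j
    have "F (X (m + j) \<omega>) \<le> F xs + r0"
    proof (induction j)
      case (Suc j)
      have "0 \<le> h / 2 * (norm (grad F (X (m + j) \<omega>)))\<^sup>2" using step_pos by simp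
      then show ?case using Suc descent[of "m + j" \<omega>] by simp
    qed (use that in simp)
    then show "\<exists>x\<in>sublevel F xs r0. F (X (m + j) \<omega>) - F xs = F x - F xs \<and>
        F (X (m + Suc j) \<omega>) - F xs \<le> F (X (m + j) \<omega>) - F xs - h / 2 * (norm (grad F x))\<^sup>2"
      using descent[of "m + j" \<omega>] by (intro bexI[of _ "X (m + j) \<omega>"]) (simp_all add: sublevel_def)
  next
    show "0 \<le> F (X (m + j) \<omega>) - F xs" for j using min_le by simp
    show "F (X (m + 0) \<omega>) - F xs \<le> r0" using that(1) by simp
  qed (fact that)+
  have "\<P>(\<omega> in P. F (X n \<omega>) - F xs \<le> \<epsilon>) \<ge> 1 - \<delta>"
    if "0 < \<epsilon>" "0 < \<delta>" "k \<epsilon> + T \<delta> \<le> n" for \<epsilon> \<delta> n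
  proof -
    have "1 - \<delta> \<le> \<P>(\<omega> in P. F (X (n - k \<epsilon>) \<omega>) \<le> F xs + r0)"
      using that by (intro T(1)) auto
    also have "\<dots> \<le> \<P>(\<omega> in P. F (X n \<omega>) - F xs \<le> \<epsilon>)"
    proof (intro finite_measure_mono subsetI)
      fix \<omega> assume "\<omega> \<in> {\<omega>\<in>space P. F (X (n - k \<epsilon>) \<omega>) \<le> F xs + r0}"
      then show "\<omega> \<in> {\<omega>\<in>space P. F (X n \<omega>) - F xs \<le> \<epsilon>}"
        using reach[of "n - k \<epsilon>" \<omega> \<epsilon> "k \<epsilon>"] that by simp
    qed measurable
    finally show ?thesis .
  qed
  moreover have "\<exists>C1 C2. \<forall>\<epsilon>\<in>{0<..<1/2}. \<forall>\<delta>\<in>{0<..<1/2}.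
      real (k \<epsilon> + T \<delta>) \<le> C1 * g \<epsilon> + C2 * ln (1 / \<delta>)"
    unfolding of_nat_add by (intro exI[of _ C1] exI[of _ C] ballI add_mono k T(2))
  ultimately show ?thesis by (intro exI[of _ "\<lambda>\<epsilon> \<delta>. k \<epsilon> + T \<delta>"] conjI allI impI)
qed

end

theorem theorem2p2:
  fixes F :: "real ^ 'd \<Rightarrow> real" and P :: "'w measure" and Z :: "nat \<Rightarrow> 'w \<Rightarrow> real ^ 'd"
    and X Y :: "nat \<Rightarrow> 'w \<Rightarrow> real ^ 'd" and x0 y0 xs :: "real ^ 'd"
    and L \<gamma> h t0 r0 ru :: real and alg :: algorithm
  assumes "F differentiable_on UNIV"
    and "smooth_assm F L"
    and "coercive_assm F"
    and "prob_space P"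
    and "iid_std_gaussian P Z"
    and "0 < \<gamma>"
    and "\<And>n \<omega>. (X n \<omega>, Y n \<omega>) = iterates alg F \<gamma> h t0 x0 y0 (\<lambda>k. Z k \<omega>) n"
  shows
    "(local_strong_convex_assm F xs r0 \<and> 0 < h \<and> h \<le> 1 / (2 * L) \<and> 0 \<le> t0 \<and> t0 \<le> r0 / 8 \<longrightarrow>
       (\<exists>N :: real \<Rightarrow> real \<Rightarrow> nat.
          (\<forall>\<epsilon>>0. \<forall>\<delta>>0. \<forall>n\<ge>N \<epsilon> \<delta>. \<P>(\<omega> in P. F (X n \<omega>) - F xs \<le> \<epsilon>) \<ge> 1 - \<delta>) \<and>
          (\<exists>C1 C2. \<forall>\<epsilon>\<in>{0<..<1/2}. \<forall>\<delta>\<in>{0<..<1/2}.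
             real (N \<epsilon> \<delta>) \<le> C1 * ln (1 / \<epsilon>) + C2 * ln (1 / \<delta>))))
     \<and>
     (local_convex_assm F xs r0 ru \<and> 0 < h \<and> h \<le> min (1 / (2 * L)) (ru\<^sup>2 / r0) \<and>
       0 \<le> t0 \<and> t0 \<le> r0 / 8 \<longrightarrow>
       (\<exists>N :: real \<Rightarrow> real \<Rightarrow> nat.
          (\<forall>\<epsilon>>0. \<forall>\<delta>>0. \<forall>n\<ge>N \<epsilon> \<delta>. \<P>(\<omega> in P. F (X n \<omega>) - F xs \<le> \<epsilon>) \<ge> 1 - \<delta>) \<and>
          (\<exists>C1 C2. \<forall>\<epsilon>\<in>{0<..<1/2}. \<forall>\<delta>\<in>{0<..<1/2}.
             real (N \<epsilon> \<delta>) \<le> C1 * (1 / \<epsilon>) + C2 * ln (1 / \<delta>))))"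
proof (intro conjI impI)
  assume *: "local_strong_convex_assm F xs r0 \<and> 0 < h \<and> h \<le> 1 / (2 * L) \<and> 0 \<le> t0 \<and> t0 \<le> r0 / 8"
  then have r0: "0 < r0" by (simp add: local_strong_convex_assm_def)
  interpret smooth_minimisation F L h xs
    using * assms by unfold_locales (auto simp: local_strong_convex_assm_def)
  obtain m where m: "0 < m"
    "\<And>x. x \<in> sublevel F xs r0 \<Longrightarrow> m * (F x - F xs) \<le> (norm (grad F x))\<^sup>2"
    using * strong_convexity_imp_gradient_growth by metis
  \<comment> \<open>The contraction factor of the excess per step, kept positive so that its logarithm makes sense.\<close>
  define \<theta> where "\<theta> = max (1 - h * m / 2) (1 / 2)"
  have \<theta>: "0 < \<theta>" "\<theta> < 1" using * m by (auto simp: \<theta>_def)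
  obtain k C where k: "\<And>d n. 0 < d \<Longrightarrow> k d \<le> n \<Longrightarrow> r0 * \<theta> ^ n \<le> d"
    "\<And>d. d \<in> {0<..<1/2} \<Longrightarrow> real (k d) \<le> C * ln (1 / d)"
    using log_threshold[OF r0 \<theta>] by metis
  show "\<exists>N :: real \<Rightarrow> real \<Rightarrow> nat.
          (\<forall>\<epsilon>>0. \<forall>\<delta>>0. \<forall>n\<ge>N \<epsilon> \<delta>. \<P>(\<omega> in P. F (X n \<omega>) - F xs \<le> \<epsilon>) \<ge> 1 - \<delta>) \<and>
          (\<exists>C1 C2. \<forall>\<epsilon>\<in>{0<..<1/2}. \<forall>\<delta>\<in>{0<..<1/2}.
             real (N \<epsilon> \<delta>) \<le> C1 * ln (1 / \<epsilon>) + C2 * ln (1 / \<delta>))"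
  proof (rule complexity_from_descent_rate[OF assms(3-7) _ _ r0 _ k(2)])
    fix a :: "nat \<Rightarrow> real" and \<epsilon> :: real and n
    assume a: "\<And>j. 0 \<le> a j" "a 0 \<le> r0" and \<epsilon>: "0 < \<epsilon>" "k \<epsilon> \<le> n"
      and desc: "\<And>j. \<exists>x\<in>sublevel F xs r0. a j = F x - F xs \<and>
        a (Suc j) \<le> a j - h / 2 * (norm (grad F x))\<^sup>2"
    have step: "a (Suc j) \<le> \<theta> * a j" for j
    proof -
      obtain x where x: "x \<in> sublevel F xs r0" "a j = F x - F xs"
        "a (Suc j) \<le> a j - h / 2 * (norm (grad F x))\<^sup>2" using desc by blast
      have "h / 2 * (m * a j) \<le> h / 2 * (norm (grad F x))\<^sup>2"
        using m(2)[OF x(1)] x(2) * by (intro mult_left_mono) auto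
      then have "a (Suc j) \<le> (1 - h * m / 2) * a j" using x(3) by (simp add: algebra_simps)
      also have "\<dots> \<le> \<theta> * a j" using a(1) by (intro mult_right_mono) (auto simp: \<theta>_def)
      finally show ?thesis .
    qed
    have "a n \<le> r0 * \<theta> ^ n"
    proof (induction n)
      case (Suc n)
      then have "\<theta> * a n \<le> \<theta> * (r0 * \<theta> ^ n)" using \<theta> by (intro mult_left_mono) auto
      then show ?case using step[of n] by (simp add: mult_ac)
    qed (use a in simp)
    then show "a n \<le> \<epsilon>" using k(1)[OF \<epsilon>] by simp
  qed (use * in auto)
next
  assume *: "local_convex_assm F xs r0 ru \<and> 0 < h \<and> h \<le> min (1 / (2 * L)) (ru\<^sup>2 / r0) \<and>
       0 \<le> t0 \<and> t0 \<le> r0 / 8"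
  then have r0: "0 < r0" and ru: "0 < ru" and convex: "local_convex_assm F xs r0 ru"
    by (auto simp: local_convex_assm_def)
  interpret smooth_minimisation F L h xs
    using * assms by unfold_locales (auto simp: local_convex_assm_def)
  define \<kappa> where "\<kappa> = h / (2 * ru\<^sup>2)"
  have \<kappa>: "0 < \<kappa>" using * ru by (simp add: \<kappa>_def)
  define k where "k \<epsilon> = nat \<lceil>1 / (\<kappa> * \<epsilon>)\<rceil>" for \<epsilon>
  have k: "real (k \<epsilon>) \<le> (1 / \<kappa> + 1) * (1 / \<epsilon>)" if "\<epsilon> \<in> {0<..<1/2}" for \<epsilon>
  proof -
    have "0 \<le> 1 / (\<kappa> * \<epsilon>)" using \<kappa> that by simp
    then have "real (k \<epsilon>) \<le> 1 / (\<kappa> * \<epsilon>) + 1" unfolding k_def by linarith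
    also have "\<dots> \<le> 1 / (\<kappa> * \<epsilon>) + 1 / \<epsilon>" using that by simp
    finally show ?thesis by (simp add: add_divide_distrib)
  qed
  show "\<exists>N :: real \<Rightarrow> real \<Rightarrow> nat.
          (\<forall>\<epsilon>>0. \<forall>\<delta>>0. \<forall>n\<ge>N \<epsilon> \<delta>. \<P>(\<omega> in P. F (X n \<omega>) - F xs \<le> \<epsilon>) \<ge> 1 - \<delta>) \<and>
          (\<exists>C1 C2. \<forall>\<epsilon>\<in>{0<..<1/2}. \<forall>\<delta>\<in>{0<..<1/2}.
             real (N \<epsilon> \<delta>) \<le> C1 * (1 / \<epsilon>) + C2 * ln (1 / \<delta>))"
  proof (rule complexity_from_descent_rate[OF assms(3-7) _ _ r0 _ k])
    fix a :: "nat \<Rightarrow> real" and \<epsilon> :: real and n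
    assume a: "\<And>j. 0 \<le> a j" "a 0 \<le> r0" and \<epsilon>: "0 < \<epsilon>" "k \<epsilon> \<le> n"
      and desc: "\<And>j. \<exists>x\<in>sublevel F xs r0. a j = F x - F xs \<and>
        a (Suc j) \<le> a j - h / 2 * (norm (grad F x))\<^sup>2"
    have "a (Suc j) \<le> a j - \<kappa> * (a j)\<^sup>2" for j
    proof -
      obtain x where x: "x \<in> sublevel F xs r0" "a j = F x - F xs"
        "a (Suc j) \<le> a j - h / 2 * (norm (grad F x))\<^sup>2" using desc by blast
      have "a j \<le> ru * norm (grad F x)"
        using convexity_imp_gradient_growth[OF convex x(1)] x(2) by simp
      then have "(a j)\<^sup>2 \<le> (ru * norm (grad F x))\<^sup>2" using a(1) by (intro power_mono) auto
      then have "\<kappa> * (a j)\<^sup>2 \<le> \<kappa> * (ru * norm (grad F x))\<^sup>2" using \<kappa> by (intro mult_left_mono) auto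
      also have "\<dots> = h / 2 * (norm (grad F x))\<^sup>2" using ru by (simp add: \<kappa>_def power_mult_distrib)
      finally show ?thesis using x(3) by simp
    qed
    then have "\<kappa> * n * a n \<le> 1" using \<kappa> a(1) by (intro quadratic_decay)
    moreover have "1 / (\<kappa> * \<epsilon>) \<le> n" using \<epsilon> by (simp add: k_def nat_le_iff ceiling_le_iff)
    then have "1 / \<epsilon> \<le> \<kappa> * n" using \<kappa> \<epsilon> by (simp add: field_simps)
    then have "1 / \<epsilon> * a n \<le> \<kappa> * n * a n" using a(1) by (intro mult_right_mono)
    ultimately have "1 / \<epsilon> * a n \<le> 1" by linarith
    then show "a n \<le> \<epsilon>" using \<epsilon> by (simp add: field_simps)
  qed (use * in auto)
qed

end
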